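(* Let $A$ be an associative triple trisystem of the first kind over $\phi$, with triple products $\{\,,\,,\,\}_1,\{\,,\,,\,\}_2,\{\,,\,,\,\}_3$. Then $A$ with the new product $$[a,b,c]=\{a,b,c\}_1-\{b,a,c\}_2-\{c,a,b\}_2+\{c,b,a\}_3\qquad(a,b,c\in A)$$ is a Leibniz triple system.
   Context: $\phi$ is a scalar ring (commutative, unital) with $\frac12\in\phi$. An associative triple trisystem of the first kind is a $\phi$-module $A$ with three trilinear maps $\{\,,\,,\,\}_i:A\times A\times A\to A$, $i\in\{1,2,3\}$, satisfying for all $a,b,c,d,e\in A$: (1) $\{\{a,b,c\}_1,d,e\}_1=\{a,\{b,c,d\}_1,e\}_1=\{a,b,\{c,d,e\}_1\}_1$; (2) $\{\{a,b,c\}_2,d,e\}_1=\{a,\{b,c,d\}_1,e\}_2=\{a,b,\{c,d,e\}_1\}_2$; (3) $\{\{a,b,c\}_3,d,e\}_1=\{a,\{b,c,d\}_2,e\}_2=\{a,b,\{c,d,e\}_1\}_3$; (4) $\{\{a,b,c\}_3,d,e\}_2=\{a,\{b,c,d\}_3,e\}_2=\{a,b,\{c,d,e\}_2\}_3$; (5) $\{\{a,b,c\}_3,d,e\}_3=\{a,\{b,c,d\}_3,e\}_3=\{a,b,\{c,d,e\}_3\}_3$; (6) $\{\{a,b,c\}_1,d,e\}_2=\{\{a,b,c\}_2,d,e\}_2=\{\{a,b,c\}_3,d,e\}_2$; (7) $\{\{a,b,c\}_1,d,e\}_3=\{\{a,b,c\}_2,d,e\}_3=\{\{a,b,c\}_3,d,e\}_3$;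 (8) $\{a,\{b,c,d\}_1,e\}_1=\{a,\{b,c,d\}_2,e\}_1=\{a,\{b,c,d\}_3,e\}_1$; (9) $\{a,\{b,c,d\}_1,e\}_3=\{a,\{b,c,d\}_2,e\}_3=\{a,\{b,c,d\}_3,e\}_3$; (10) $\{a,b,\{c,d,e\}_1\}_1=\{a,b,\{c,d,e\}_2\}_1=\{a,b,\{c,d,e\}_3\}_1$; (11) $\{a,b,\{c,d,e\}_1\}_2=\{a,b,\{c,d,e\}_2\}_2=\{a,b,\{c,d,e\}_3\}_2$. A Leibniz triple system is a $\phi$-module $T$ with a trilinear operation $[\,,\,,\,]:T\times T\times T\to T$ satisfying for all $a,b,c,d,e\in T$: (LTSA) $[a,b,[c,d,e]]-[[a,b,c],d,e]+[[a,b,d],c,e]-[[a,b,e],d,c]+[[a,b,e],c,d]=0$; (LTSB) $[a,[b,c,d],e]-[[a,b,c],d,e]+[[a,c,b],d,e]+[[a,d,b],c,e]-[[a,d,c],b,e]=0$. *)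

theory Defs
  imports Complex_Main
begin

text \<open>
  A \<open>\<phi>\<close>-module is given by the library locale \<^locale>\<open>module\<close>: the scalar ring is a type of
  class \<^class>\<open>comm_ring_1\<close>, the underlying abelian group a type of class
  \<^class>\<open>ab_group_add\<close>, and \<open>scale\<close> is the action.
\<close>

definition trilinear ::
  "('r::comm_ring_1 \<Rightarrow> 'a::ab_group_add \<Rightarrow> 'a) \<Rightarrow> ('a \<Rightarrow> 'a \<Rightarrow> 'a \<Rightarrow> 'a) \<Rightarrow> bool" where
  "trilinear scale f \<longleftrightarrow>
     (\<forall>b c. module_hom scale scale (\<lambda>a. f a b c)) \<and>
     (\<forall>a c. module_hom scale scale (\<lambda>b. f a b c)) \<and>
     (\<forall>a b. module_hom scale scale (\<lambda>c. f a b c))"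

text \<open>Associative triple trisystems of the first kind; \<open>t1\<close>, \<open>t2\<close>, \<open>t3\<close> are the products
  \<open>{_,_,_}\<^sub>1\<close>, \<open>{_,_,_}\<^sub>2\<close>, \<open>{_,_,_}\<^sub>3\<close>.\<close>

locale assoc_triple_trisystem_first = module scale
  for scale :: "'r::comm_ring_1 \<Rightarrow> 'a::ab_group_add \<Rightarrow> 'a" +
  fixes t1 t2 t3 :: "'a \<Rightarrow> 'a \<Rightarrow> 'a \<Rightarrow> 'a"
  assumes trilinear_t1: "trilinear scale t1"
    and trilinear_t2: "trilinear scale t2"
    and trilinear_t3: "trilinear scale t3"
    and ax1: "t1 (t1 a b c) d e = t1 a (t1 b c d) e"
             "t1 a (t1 b c d) e = t1 a b (t1 c d e)"
    and ax2: "t1 (t2 a b c) d e = t2 a (t1 b c d) e"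
             "t2 a (t1 b c d) e = t2 a b (t1 c d e)"
    and ax3: "t1 (t3 a b c) d e = t2 a (t2 b c d) e"
             "t2 a (t2 b c d) e = t3 a b (t1 c d e)"
    and ax4: "t2 (t3 a b c) d e = t2 a (t3 b c d) e"
             "t2 a (t3 b c d) e = t3 a b (t2 c d e)"
    and ax5: "t3 (t3 a b c) d e = t3 a (t3 b c d) e"
             "t3 a (t3 b c d) e = t3 a b (t3 c d e)"
    and ax6: "t2 (t1 a b c) d e = t2 (t2 a b c) d e"
             "t2 (t2 a b c) d e = t2 (t3 a b c) d e"
    and ax7: "t3 (t1 a b c) d e = t3 (t2 a b c) d e"
             "t3 (t2 a b c) d e = t3 (t3 a b c) d e"
    and ax8: "t1 a (t1 b c d) e = t1 a (t2 b c d) e"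
             "t1 a (t2 b c d) e = t1 a (t3 b c d) e"
    and ax9: "t3 a (t1 b c d) e = t3 a (t2 b c d) e"
             "t3 a (t2 b c d) e = t3 a (t3 b c d) e"
    and ax10: "t1 a b (t1 c d e) = t1 a b (t2 c d e)"
              "t1 a b (t2 c d e) = t1 a b (t3 c d e)"
    and ax11: "t2 a b (t1 c d e) = t2 a b (t2 c d e)"
              "t2 a b (t2 c d e) = t2 a b (t3 c d e)"

locale leibniz_triple_system = module scale
  for scale :: "'r::comm_ring_1 \<Rightarrow> 'a::ab_group_add \<Rightarrow> 'a" +
  fixes br :: "'a \<Rightarrow> 'a \<Rightarrow> 'a \<Rightarrow> 'a"
  assumes trilinear_br: "trilinear scale br"
    and LTSA: "br a b (br c d e) - br (br a b c) d e + br (br a b d) c e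
               - br (br a b e) d c + br (br a b e) c d = 0"
    and LTSB: "br a (br b c d) e - br (br a b c) d e + br (br a c b) d e
               + br (br a d b) c e - br (br a d c) b e = 0"

end

(* Every nested product of a, b, c, d, e is determined by the order of its factors and by one marked
   position in 1..5: the product t_i marks its i-th argument, and a marked inner product passes the
   mark on to its own marked argument. The axioms say exactly that all nested products with the same
   word and mark agree. After expanding the brackets and bringing each term to a left-nested
   representative, the two identities hold by cancellation. *)
theory Submission
  imports Defs
begin

lemma trilinear_iff:
  assumes "module scale"
  shows "trilinear scale f \<longleftrightarrow>
    (\<forall>a a' b c. f (a + a') b c = f a b c + f a' b c) \<and>
    (\<forall>a b b' c. f a (b + b') c = f a b c + f a b' c) \<and>
    (\<forall>a b c c'. f a b (c + c') = f a b c + f a b c') \<and>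
    (\<forall>r a b c. f (scale r a) b c = scale r (f a b c)) \<and>
    (\<forall>r a b c. f a (scale r b) c = scale r (f a b c)) \<and>
    (\<forall>r a b c. f a b (scale r c) = scale r (f a b c))"
  by (auto simp: trilinear_def module_hom_iff assms)

text \<open>The minus signs in the bracket call for distributivity over differences, which
  homomorphisms in each argument provide.\<close>

lemma trilinear_diff:
  assumes "trilinear scale f"
  shows "f (a - a') b c = f a b c - f a' b c"
    and "f a (b - b') c = f a b c - f a b' c"
    and "f a b (c - c') = f a b c - f a b c'"
proof -
  have "module_hom scale scale (\<lambda>x. f x b c)" "module_hom scale scale (\<lambda>x. f a x c)"
    "module_hom scale scale (\<lambda>x. f a b x)"
    using assms by (simp_all add: trilinear_def)
  from this[THEN module_hom.diff]
  show "f (a - a') b c = f a b c - f a' b c" "f a (b - b') c = f a b c - f a b' c"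
    "f a b (c - c') = f a b c - f a b c'" .
qed

context assoc_triple_trisystem_first
begin

lemmas trilinear_rules =
  trilinear_t1[unfolded trilinear_iff[OF module_axioms]]
  trilinear_t2[unfolded trilinear_iff[OF module_axioms]]
  trilinear_t3[unfolded trilinear_iff[OF module_axioms]]
  trilinear_diff[OF trilinear_t1] trilinear_diff[OF trilinear_t2] trilinear_diff[OF trilinear_t3]

lemma left_nested_mark1:
  "t1 a (t1 b c d) e = t1 (t1 a b c) d e"
  "t1 a (t2 b c d) e = t1 (t1 a b c) d e"
  "t1 a (t3 b c d) e = t1 (t1 a b c) d e"
  "t1 a b (t1 c d e) = t1 (t1 a b c) d e"
  "t1 a b (t2 c d e) = t1 (t1 a b c) d e"
  "t1 a b (t3 c d e) = t1 (t1 a b c) d e"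
  \<comment> \<open>Both sides meet in the right-nested \<open>t1 a b (t1 c d e)\<close>. Reversing
    \<open>ax8\<close> and \<open>ax10\<close> turns inner \<open>t2\<close> and \<open>t3\<close>
    into \<open>t1\<close>, where \<open>ax1\<close> applies.\<close>
  by (simp_all only: ax1 ax8[symmetric] ax10[symmetric])

lemma left_nested_mark2:
  "t2 a (t1 b c d) e = t1 (t2 a b c) d e"
  "t2 a b (t1 c d e) = t1 (t2 a b c) d e"
  "t2 a b (t2 c d e) = t1 (t2 a b c) d e"
  "t2 a b (t3 c d e) = t1 (t2 a b c) d e"
  by (simp_all only: ax2 ax11[symmetric])

lemma left_nested_mark3:
  "t2 a (t2 b c d) e = t1 (t3 a b c) d e"
  "t3 a b (t1 c d e) = t1 (t3 a b c) d e"
  by (simp_all only: ax3)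

lemma left_nested_mark4:
  "t2 (t1 a b c) d e = t2 (t3 a b c) d e"
  "t2 (t2 a b c) d e = t2 (t3 a b c) d e"
  "t2 a (t3 b c d) e = t2 (t3 a b c) d e"
  "t3 a b (t2 c d e) = t2 (t3 a b c) d e"
  by (simp_all only: ax4 ax6)

lemma left_nested_mark5:
  "t3 (t1 a b c) d e = t3 (t3 a b c) d e"
  "t3 (t2 a b c) d e = t3 (t3 a b c) d e"
  "t3 a (t1 b c d) e = t3 (t3 a b c) d e"
  "t3 a (t2 b c d) e = t3 (t3 a b c) d e"
  "t3 a (t3 b c d) e = t3 (t3 a b c) d e"
  "t3 a b (t3 c d e) = t3 (t3 a b c) d e"
  by (simp_all only: ax5 ax7 ax9)

text \<open>There are 27 nested products: these 22 left-hand sides and five representatives, one per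
  mark.\<close>

lemmas left_nested = left_nested_mark1 left_nested_mark2 left_nested_mark3
  left_nested_mark4 left_nested_mark5

text \<open>This is the commutator [[a,b],c] = abc - bac - cab + cba, each word formed by the
  product that marks the position of \<open>a\<close>.\<close>

definition bracket :: "'a \<Rightarrow> 'a \<Rightarrow> 'a \<Rightarrow> 'a" where
  "bracket a b c = t1 a b c - t2 b a c - t2 c a b + t3 c b a"

lemma trilinear_bracket: "trilinear scale bracket"
  unfolding trilinear_iff[OF module_axioms] bracket_def
  by (simp add: trilinear_rules scale_right_distrib scale_right_diff_distrib)

text \<open>The mark stays on \<open>a\<close> in every term, so the words cancel as in an
  associative algebra, where this is the Jacobi expansion of [u,[[c,d],e]] with u = [a,b].\<close>

lemma bracket_LTSA:
  "bracket a b (bracket c d e) - bracket (bracket a b c) d e + bracket (bracket a b d) c e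
    - bracket (bracket a b e) d c + bracket (bracket a b e) c d = 0"
  unfolding bracket_def by (simp add: trilinear_rules left_nested)

text \<open>Again \<open>a\<close> carries every mark; the cancellation is the Jacobi expansion of
  [a,[[b,c],d]], bracketed with \<open>e\<close>.\<close>

lemma bracket_LTSB:
  "bracket a (bracket b c d) e - bracket (bracket a b c) d e + bracket (bracket a c b) d e
    + bracket (bracket a d b) c e - bracket (bracket a d c) b e = 0"
  unfolding bracket_def by (simp add: trilinear_rules left_nested)

end

theorem theorem3:
  fixes scale :: "'r::comm_ring_1 \<Rightarrow> 'a::ab_group_add \<Rightarrow> 'a"
    and t1 t2 t3 :: "'a \<Rightarrow> 'a \<Rightarrow> 'a \<Rightarrow> 'a"
  assumes half: "\<exists>h::'r. 2 * h = 1"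
    and "assoc_triple_trisystem_first scale t1 t2 t3"
  shows "leibniz_triple_system scale
           (\<lambda>a b c. t1 a b c - t2 b a c - t2 c a b + t3 c b a)"
proof -
  interpret assoc_triple_trisystem_first scale t1 t2 t3 by fact
  have "leibniz_triple_system scale bracket"
    by unfold_locales (fact trilinear_bracket bracket_LTSA bracket_LTSB)+
  then show ?thesis
    by (simp only: bracket_def[abs_def])
qed

end
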